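(* Let $n$ be a positive integer with $n\ge 10$. Then $r(T_n,T_n^* )=2n-5$ for every $T_n\in\{T_n'',T_n''',T_n^3\}$.
   Context: All graphs are finite simple graphs. For graphs $G_1,G_2$, the Ramsey number $r(G_1,G_2)$ is the smallest positive integer $N$ such that for every graph $G$ on $N$ vertices, either $G$ contains a (not necessarily induced) subgraph isomorphic to $G_1$, or the complement $\overline{G}$ contains a subgraph isomorphic to $G_2$. On vertex set $\{v_0,\ldots,v_{n-1}\}$: $T_n^*$ has edges $v_0v_1,\ldots,v_0v_{n-3},v_{n-3}v_{n-2},v_{n-2}v_{n-1}$; $T_n''$ has edges $v_0v_1,\ldots,v_0v_{n-4},v_1v_{n-3},v_1v_{n-2},v_2v_{n-1}$; $T_n'''$ has edges $v_0v_1,\ldots,v_0v_{n-4},v_1v_{n-3},v_2v_{n-2},v_3v_{n-1}$; $T_n^3$ has edges $v_0v_1,\ldots,v_0v_{n-4},v_{n-4}v_{n-3},v_{n-4}v_{n-2},v_{n-4}v_{n-1}$. *)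

theory Defs
  imports "Graph_Theory.Graph_Theory"
begin

text \<open>
  A finite simple graph is a \<open>pair_graph\<close> of the AFP entry Graph Theory, i.e. a finite,
  loop-free, symmetric digraph without parallel arcs: the edge \<open>uv\<close> is the pair of arcs
  \<open>(u,v)\<close> and \<open>(v,u)\<close>.
\<close>

definition graph_of_edges :: "nat \<Rightarrow> (nat \<times> nat) set \<Rightarrow> nat pair_pre_digraph" where
  "graph_of_edges n E = \<lparr> pverts = {0..<n}, parcs = E \<union> E\<inverse> \<rparr>"

definition graph_complement :: "'a pair_pre_digraph \<Rightarrow> 'a pair_pre_digraph" where
  "graph_complement G =
    \<lparr> pverts = pverts G,
      parcs = {(u, v). u \<in> pverts G \<and> v \<in> pverts G \<and> u \<noteq> v \<and> (u, v) \<notin> parcs G} \<rparr>"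

text \<open>The library's \<open>subgraph\<close> is the not necessarily induced notion.\<close>

definition contains_copy :: "'a pair_pre_digraph \<Rightarrow> 'b pair_pre_digraph \<Rightarrow> bool" where
  "contains_copy G H \<longleftrightarrow>
    (\<exists>H' :: 'a pair_pre_digraph.
       subgraph (with_proj H') (with_proj G) \<and> digraph_iso (with_proj H) (with_proj H'))"

text \<open>
  Every finite graph is isomorphic to one whose vertices are natural numbers, so the
  quantifier over host graphs loses no generality.
\<close>

definition ramsey_number :: "'a pair_pre_digraph \<Rightarrow> 'b pair_pre_digraph \<Rightarrow> nat" where
  "ramsey_number G1 G2 =
    (LEAST N. 0 < N \<and>
      (\<forall>G :: nat pair_pre_digraph. pair_graph G \<and> card (pverts G) = N \<longrightarrow>
         contains_copy G G1 \<or> contains_copy (graph_complement G) G2))"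

text \<open>
  The trees \<open>T\<^sub>n\<^sup>*\<close>, \<open>T\<^sub>n''\<close>, \<open>T\<^sub>n'''\<close> and \<open>T\<^sub>n\<^sup>3\<close>, with vertex
  \<open>v\<^sub>i\<close> represented by \<open>i\<close>.  Natural-number subtraction is truncated, so the definitions
  are meaningful only for \<open>n\<close> large enough (certainly for \<open>n \<ge> 10\<close>).
\<close>

definition tree_star :: "nat \<Rightarrow> nat pair_pre_digraph" where
  "tree_star n = graph_of_edges n
    ({(0, i) | i. 1 \<le> i \<and> i \<le> n - 3} \<union> {(n - 3, n - 2), (n - 2, n - 1)})"

definition tree_dprime :: "nat \<Rightarrow> nat pair_pre_digraph" where
  "tree_dprime n = graph_of_edges n
    ({(0, i) | i. 1 \<le> i \<and> i \<le> n - 4} \<union> {(1, n - 3), (1, n - 2), (2, n - 1)})"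

definition tree_tprime :: "nat \<Rightarrow> nat pair_pre_digraph" where
  "tree_tprime n = graph_of_edges n
    ({(0, i) | i. 1 \<le> i \<and> i \<le> n - 4} \<union> {(1, n - 3), (2, n - 2), (3, n - 1)})"

definition tree_three :: "nat \<Rightarrow> nat pair_pre_digraph" where
  "tree_three n = graph_of_edges n
    ({(0, i) | i. 1 \<le> i \<and> i \<le> n - 4} \<union> {(n - 4, n - 3), (n - 4, n - 2), (n - 4, n - 1)})"

end

theory Submission
  imports Defs
begin

text \<open>
  Two disjoint cliques on \<open>n - 3\<close> vertices each give the lower bound.

  For the upper bound let \<open>G\<close> be a graph on \<open>2n - 5\<close> vertices avoiding \<open>T\<close>, with complement \<open>H\<close>
  avoiding \<open>T\<^sub>n\<^sup>*\<close>.  All three trees \<open>T\<close> embed greedily at a vertex \<open>x\<close> whose neighbourhood, with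
  one further vertex \<open>s\<close> at distance two added if necessary, has at least \<open>n - 1\<close> elements, as soon
  as the degrees are at least 6.
  If some vertex \<open>v\<close> has degree at least \<open>n - 1\<close> in \<open>H\<close>, then \<open>H - v\<close> has no path with three vertices
  starting at a neighbour of \<open>v\<close>; so \<open>H\<close> is a matching on some \<open>n\<close> vertices, and \<open>G\<close> contains \<open>T\<close>
  there.  Otherwise \<open>G\<close> has minimum degree at least \<open>n - 4\<close>.  A vertex of degree at least \<open>n - 2\<close> in
  \<open>G\<close> would span a component of order \<open>n - 1\<close>, leaving \<open>n - 4\<close> vertices of too small degree.
  Hence all degrees in \<open>H\<close> are \<open>n - 3\<close> or \<open>n - 2\<close>; a vertex \<open>v\<close> of degree \<open>n - 2\<close> is excluded by a path
  in \<open>H\<close> from \<open>v\<close> through a non-neighbour, and when \<open>H\<close> is \<open>(n - 3)\<close>-regular all non-neighbours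
  of \<open>v\<close> have the same neighbourhood as \<open>v\<close>, which contradicts regularity.
\<close>

section \<open>Embeddings\<close>

text \<open>An embedding is presented as a list, vertex \<open>i\<close> going to
  \<open>xs ! i\<close>. One orientation of each edge suffices, since \<open>parcs G\<close> is
  symmetric.\<close>

lemma contains_copyI:
  assumes "pair_graph G" and "distinct xs" and "set xs \<subseteq> pverts G"
    and "\<And>i j. (i, j) \<in> E \<Longrightarrow> i < length xs \<and> j < length xs \<and> (xs ! i, xs ! j) \<in> parcs G"
  shows "contains_copy G (graph_of_edges (length xs) E)"
proof -
  interpret G: pair_graph G by fact
  let ?H = "graph_of_edges (length xs) E"
  let ?f = "\<lambda>i. xs ! i"
  \<comment> \<open>Taking \<open>snd\<close> and \<open>fst\<close> as head and tail makes the
    image digraph again of the form \<open>with_proj\<close>.\<close>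
  let ?hom = "\<lparr> iso_verts = ?f, iso_arcs = map_prod ?f ?f, iso_head = snd, iso_tail = fst \<rparr>"
  let ?H' = "\<lparr> pverts = ?f ` pverts ?H, parcs = map_prod ?f ?f ` parcs ?H \<rparr>"
  have sym: "(v, u) \<in> parcs G" if "(u, v) \<in> parcs G" for u v
    using that G.pair_sym_arcs by (auto simp: symmetric_def dest: symD)
  have arcs: "i < length xs \<and> j < length xs \<and> (xs ! i, xs ! j) \<in> parcs G"
    if "(i, j) \<in> parcs ?H" for i j
    using that assms(4) sym by (auto simp: graph_of_edges_def)
  have inj: "inj_on ?f {0..<length xs}"
    using assms(2) by (auto simp: inj_on_def nth_eq_iff_index_eq)
  have sub: "parcs ?H \<subseteq> {0..<length xs} \<times> {0..<length xs}"
    using arcs by auto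
  have vH: "pverts ?H = {0..<length xs}"
    by (simp add: graph_of_edges_def)
  have wfH: "wf_digraph (with_proj ?H)"
    using sub vH by unfold_locales auto
  have "inj_on (map_prod ?f ?f) (parcs ?H)"
    using map_prod_inj_on[OF inj inj] sub inj_on_subset by blast
  then have "pre_digraph.digraph_isomorphism (with_proj ?H) ?hom"
    unfolding pre_digraph.digraph_isomorphism_def
    using wfH inj by (auto simp: graph_of_edges_def)
  moreover have "with_proj ?H' = app_iso ?hom (with_proj ?H)"
    by (simp add: app_iso_def with_proj_def)
  ultimately have "digraph_iso (with_proj ?H) (with_proj ?H')"
    unfolding digraph_iso_def by blast
  moreover have "subgraph (with_proj ?H') (with_proj G)"
  proof -
    have "wf_digraph (with_proj ?H')"
      using sub vH by unfold_locales fastforce+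
    moreover have "?f ` pverts ?H \<subseteq> pverts G"
      using assms(3) by (auto simp: graph_of_edges_def)
    ultimately show ?thesis
      using arcs by (auto simp: subgraph_def compatible_def G.wf_digraph)
  qed
  ultimately show ?thesis
    unfolding contains_copy_def by blast
qed

lemma contains_copyE:
  assumes "contains_copy G (graph_of_edges n E)"
  obtains f where "inj_on f {0..<n}" and "f ` {0..<n} \<subseteq> pverts G"
    and "\<And>i j. (i, j) \<in> E \<Longrightarrow> (f i, f j) \<in> parcs G"
proof -
  let ?H = "graph_of_edges n E"
  obtain H' where sub: "subgraph (with_proj H') (with_proj G)"
    and iso: "digraph_iso (with_proj ?H) (with_proj H')"
    using assms unfolding contains_copy_def by blast
  obtain h where h: "pre_digraph.digraph_isomorphism (with_proj ?H) h"
    and H': "with_proj H' = app_iso h (with_proj ?H)"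
    using iso unfolding digraph_iso_def by blast
  have "inj_on (iso_verts h) {0..<n}"
    using h by (simp add: pre_digraph.digraph_isomorphism_def graph_of_edges_def)
  moreover have "iso_verts h ` {0..<n} \<subseteq> pverts G"
    using sub arg_cong[OF H', of verts] by (simp add: subgraph_def graph_of_edges_def)
  moreover have "(iso_verts h i, iso_verts h j) \<in> parcs G" if "(i, j) \<in> E" for i j
  proof -
    have ij: "(i, j) \<in> parcs ?H"
      using that by (simp add: graph_of_edges_def)
    then have "iso_verts h i = iso_tail h (iso_arcs h (i, j))"
      and "iso_verts h j = iso_head h (iso_arcs h (i, j))"
      using h unfolding pre_digraph.digraph_isomorphism_def by fastforce+
    moreover have "iso_tail h = fst" "iso_head h = snd"
      using arg_cong[OF H', of tail] arg_cong[OF H', of head] by simp_all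
    moreover have "iso_arcs h (i, j) \<in> parcs G"
      using sub ij arg_cong[OF H', of arcs] by (auto simp: subgraph_def)
    ultimately show ?thesis by simp
  qed
  ultimately show thesis by (rule that)
qed

lemma ex_not_in_list:
  assumes "length l < card A"
  shows "\<exists>y \<in> A. y \<notin> set l"
proof (rule ccontr)
  assume "\<not> ?thesis"
  then have "A \<subseteq> set l" by blast
  then have "card A \<le> card (set l)" by (simp add: card_mono)
  then show False using assms card_length[of l] by linarith
qed

lemma distinct_list_of_length:
  assumes "k \<le> card A"
  obtains ys where "distinct ys" and "set ys \<subseteq> A" and "length ys = k"
proof -
  obtain B where "B \<subseteq> A" "card B = k" "finite B"
    using obtain_subset_with_card_n[OF assms] by metis
  then show thesis
    using finite_distinct_list[of B] that distinct_card by metis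
qed

lemma card_Diff_list:
  "card A \<le> card (A - set l) + length l"
proof (cases "finite A")
  case True
  have "card A \<le> card ((A - set l) \<union> set l)"
    using True by (intro card_mono) auto
  also have "\<dots> \<le> card (A - set l) + length l"
    using card_Un_le[of "A - set l" "set l"] card_length[of l] by linarith
  finally show ?thesis .
qed simp

section \<open>Each tree from its edges off the centre and a supply of leaves\<close>

lemma contains_tree_star:
  assumes "pair_graph G" and "n \<ge> 4"
    and arcs: "(x, a) \<in> parcs G" "(a, b) \<in> parcs G" "(b, c) \<in> parcs G"
    and ne: "b \<noteq> x" "c \<noteq> x" "c \<noteq> a"
    and "n - 4 \<le> card (parcs G `` {x} - set [a, b, c])"
  shows "contains_copy G (tree_star n)"
proof -
  interpret G: pair_graph G by fact
  obtain ys where ys: "distinct ys" "set ys \<subseteq> parcs G `` {x} - set [a, b, c]" "length ys = n - 4"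
    using distinct_list_of_length assms(9) by metis
  \<comment> \<open>The list follows the numbering of the tree: centre at 0, leaves at 1 to
    \<open>n - 4\<close>, then the path from index \<open>n - 3\<close>. Distinctness of consecutive
    path vertices comes from the absence of loops.\<close>
  let ?xs = "x # ys @ [a, b, c]"
  have len: "length ?xs = n" using ys(3) assms(2) by simp
  have loop: "(z, z) \<notin> parcs G" for z
    using G.pair_no_loops by fastforce
  have leaf: "(x, ys ! i) \<in> parcs G" if "i < length ys" for i
    using ys(2) nth_mem[OF that] by auto
  have V: "set ?xs \<subseteq> pverts G"
    using ys(2) arcs G.in_arcsD1 G.in_arcsD2 by (auto 0 3)
  have dist: "distinct ?xs"
    using ys(1,2) ne loop arcs by auto
  have "contains_copy G (graph_of_edges (length ?xs)
    ({(0, i) | i. 1 \<le> i \<and> i \<le> n - 3} \<union> {(n - 3, n - 2), (n - 2, n - 1)}))"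
  proof (rule contains_copyI[OF assms(1) dist V])
    fix i j :: nat
    assume "(i, j) \<in> {(0, i) | i. 1 \<le> i \<and> i \<le> n - 3} \<union> {(n - 3, n - 2), (n - 2, n - 1)}"
    then consider "i = 0" "1 \<le> j" "j < n - 3" | "i = 0" "j = n - 3"
      | "i = n - 3" "j = n - 2" | "i = n - 2" "j = n - 1" by force
    then show "i < length ?xs \<and> j < length ?xs \<and> (?xs ! i, ?xs ! j) \<in> parcs G"
      using ys(3) assms(2) arcs leaf
      by cases (auto simp: nth_Cons' nth_append, arith+)
  qed
  then show ?thesis
    unfolding len tree_star_def .
qed

lemma contains_tree_three:
  assumes "pair_graph G" and "n \<ge> 6"
    and arcs: "(x, u) \<in> parcs G" "(u, s) \<in> parcs G" "(u, p) \<in> parcs G" "(u, q) \<in> parcs G"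
    and ne: "distinct [x, s, p, q]"
    and "n - 5 \<le> card (parcs G `` {x} - set [u, s, p, q])"
  shows "contains_copy G (tree_three n)"
proof -
  interpret G: pair_graph G by fact
  obtain ys where ys: "distinct ys" "set ys \<subseteq> parcs G `` {x} - set [u, s, p, q]"
    "length ys = n - 5"
    using distinct_list_of_length assms(8) by metis
  let ?xs = "x # ys @ [u, s, p, q]"
  have len: "length ?xs = n" using ys(3) assms(2) by simp
  have loop: "(z, z) \<notin> parcs G" for z
    using G.pair_no_loops by fastforce
  have leaf: "(x, ys ! i) \<in> parcs G" if "i < length ys" for i
    using ys(2) nth_mem[OF that] by auto
  have V: "set ?xs \<subseteq> pverts G"
    using ys(2) arcs G.in_arcsD1 G.in_arcsD2 by (auto 0 3)
  have dist: "distinct ?xs"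
    using ys(1,2) ne loop arcs by auto
  have "contains_copy G (graph_of_edges (length ?xs)
    ({(0, i) | i. 1 \<le> i \<and> i \<le> n - 4} \<union> {(n - 4, n - 3), (n - 4, n - 2), (n - 4, n - 1)}))"
  proof (rule contains_copyI[OF assms(1) dist V])
    fix i j :: nat
    assume "(i, j) \<in> {(0, i) | i. 1 \<le> i \<and> i \<le> n - 4}
      \<union> {(n - 4, n - 3), (n - 4, n - 2), (n - 4, n - 1)}"
    then consider "i = 0" "1 \<le> j" "j < n - 4" | "i = 0" "j = n - 4"
      | "i = n - 4" "j = n - 3" | "i = n - 4" "j = n - 2" | "i = n - 4" "j = n - 1" by force
    then show "i < length ?xs \<and> j < length ?xs \<and> (?xs ! i, ?xs ! j) \<in> parcs G"
      using ys(3) assms(2) arcs leaf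
      by cases (auto simp: nth_Cons' nth_append)
  qed
  then show ?thesis
    unfolding len tree_three_def .
qed

lemma contains_tree_dprime:
  assumes "pair_graph G" and "n \<ge> 6"
    and arcs: "(x, u) \<in> parcs G" "(x, w) \<in> parcs G"
      "(u, s) \<in> parcs G" "(u, p) \<in> parcs G" "(w, q) \<in> parcs G"
    and ne: "distinct [x, u, w, s, p, q]"
    and "n - 6 \<le> card (parcs G `` {x} - set [u, w, s, p, q])"
  shows "contains_copy G (tree_dprime n)"
proof -
  interpret G: pair_graph G by fact
  obtain ys where ys: "distinct ys" "set ys \<subseteq> parcs G `` {x} - set [u, w, s, p, q]"
    "length ys = n - 6"
    using distinct_list_of_length assms(9) by metis
  let ?xs = "x # u # w # ys @ [s, p, q]"
  have len: "length ?xs = n" using ys(3) assms(2) by simp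
  have loop: "(z, z) \<notin> parcs G" for z
    using G.pair_no_loops by fastforce
  have leaf: "(x, ys ! i) \<in> parcs G" if "i < length ys" for i
    using ys(2) nth_mem[OF that] by auto
  have V: "set ?xs \<subseteq> pverts G"
    using ys(2) arcs G.in_arcsD1 G.in_arcsD2 by (auto 0 3)
  have dist: "distinct ?xs"
    using ys(1,2) ne loop arcs by auto
  have "contains_copy G (graph_of_edges (length ?xs)
    ({(0, i) | i. 1 \<le> i \<and> i \<le> n - 4} \<union> {(1, n - 3), (1, n - 2), (2, n - 1)}))"
  proof (rule contains_copyI[OF assms(1) dist V])
    fix i j :: nat
    assume "(i, j) \<in> {(0, i) | i. 1 \<le> i \<and> i \<le> n - 4} \<union> {(1, n - 3), (1, n - 2), (2, n - 1)}"
    then consider "i = 0" "j = 1" | "i = 0" "j = 2" | "i = 0" "3 \<le> j" "j \<le> n - 4"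
      | "i = 1" "j = n - 3" | "i = 1" "j = n - 2" | "i = 2" "j = n - 1" by force
    then show "i < length ?xs \<and> j < length ?xs \<and> (?xs ! i, ?xs ! j) \<in> parcs G"
      using ys(3) assms(2) arcs leaf
      by cases (auto simp: nth_Cons' nth_append)
  qed
  then show ?thesis
    unfolding len tree_dprime_def .
qed

lemma contains_tree_tprime:
  assumes "pair_graph G" and "n \<ge> 7"
    and arcs: "(x, u) \<in> parcs G" "(x, v) \<in> parcs G" "(x, w) \<in> parcs G"
      "(u, s) \<in> parcs G" "(v, p) \<in> parcs G" "(w, q) \<in> parcs G"
    and ne: "distinct [x, u, v, w, s, p, q]"
    and "n - 7 \<le> card (parcs G `` {x} - set [u, v, w, s, p, q])"
  shows "contains_copy G (tree_tprime n)"
proof -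
  interpret G: pair_graph G by fact
  obtain ys where ys: "distinct ys" "set ys \<subseteq> parcs G `` {x} - set [u, v, w, s, p, q]"
    "length ys = n - 7"
    using distinct_list_of_length assms(10) by metis
  let ?xs = "x # u # v # w # ys @ [s, p, q]"
  have len: "length ?xs = n" using ys(3) assms(2) by simp
  have loop: "(z, z) \<notin> parcs G" for z
    using G.pair_no_loops by fastforce
  have leaf: "(x, ys ! i) \<in> parcs G" if "i < length ys" for i
    using ys(2) nth_mem[OF that] by auto
  have V: "set ?xs \<subseteq> pverts G"
    using ys(2) arcs G.in_arcsD1 G.in_arcsD2 by (auto 0 3)
  have dist: "distinct ?xs"
    using ys(1,2) ne loop arcs by auto
  have "contains_copy G (graph_of_edges (length ?xs)
    ({(0, i) | i. 1 \<le> i \<and> i \<le> n - 4} \<union> {(1, n - 3), (2, n - 2), (3, n - 1)}))"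
  proof (rule contains_copyI[OF assms(1) dist V])
    fix i j :: nat
    assume "(i, j) \<in> {(0, i) | i. 1 \<le> i \<and> i \<le> n - 4} \<union> {(1, n - 3), (2, n - 2), (3, n - 1)}"
    then consider "i = 0" "j = 1" | "i = 0" "j = 2" | "i = 0" "j = 3" | "i = 0" "4 \<le> j" "j \<le> n - 4"
      | "i = 1" "j = n - 3" | "i = 2" "j = n - 2" | "i = 3" "j = n - 1" by force
    then show "i < length ?xs \<and> j < length ?xs \<and> (?xs ! i, ?xs ! j) \<in> parcs G"
      using ys(3) assms(2) arcs leaf
      by cases (auto simp: nth_Cons' nth_append)
  qed
  then show ?thesis
    unfolding len tree_tprime_def .
qed

section \<open>Finding the trees\<close>

text \<open>The pendant paths are chosen greedily, starting with the edge \<open>us\<close>; since \<open>s\<close> is counted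
  in addition to the neighbours of \<open>x\<close>, enough of the latter remain as leaves.\<close>

lemma contains_tree_if_large_degree:
  assumes G: "pair_graph G" and n: "n \<ge> 10" and R: "R \<subseteq> parcs G"
    and T: "T \<in> {tree_dprime n, tree_tprime n, tree_three n}"
    and xu: "(x, u) \<in> R" and us: "(u, s) \<in> R" and sx: "s \<noteq> x"
    and large: "n - 1 \<le> card (insert s (R `` {x}))"
    and deg: "\<And>y z. (y, z) \<in> R \<Longrightarrow> 6 \<le> card (R `` {y}) \<and> 6 \<le> card (R `` {z})"
  shows "contains_copy G T"
proof -
  interpret G: pair_graph G by fact
  \<comment> \<open>At most five vertices must be avoided at once, namely for \<open>q\<close> in
    the case of \<open>tree_tprime\<close>; hence degree 6.\<close>
  have pick: "\<exists>z. (y, z) \<in> R \<and> z \<notin> set l" if "6 \<le> card (R `` {y})" "length l \<le> 5" for y l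
    using ex_not_in_list[of l "R `` {y}"] that by auto
  have loop: "(z, z) \<notin> R" for z
    using G.pair_no_loops R by fastforce
  have fin: "finite (parcs G `` {x})"
    by (rule finite_subset[OF _ G.pair_finite_verts]) (use G.in_arcsD2 in blast)
  \<comment> \<open>Removing \<open>s\<close>, \<open>p\<close>, \<open>q\<close> from the enlarged
    neighbourhood leaves only neighbours of \<open>x\<close>, whether or not \<open>s\<close> is
    one, so at least \<open>(n - 1) - 3\<close> of them remain.\<close>
  have rest: "n - 4 \<le> card (parcs G `` {x} - {s, p, q})" for p q
  proof -
    have "n - 1 \<le> card (insert s (R `` {x}) - set [s, p, q]) + 3"
      using large card_Diff_list[of "insert s (R `` {x})" "[s, p, q]"] by simp
    also have "card (insert s (R `` {x}) - set [s, p, q]) \<le> card (parcs G `` {x} - {s, p, q})"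
      using R fin by (intro card_mono) auto
    finally show ?thesis using n by linarith
  qed
  have remove: "n - 4 - length l \<le> card (parcs G `` {x} - (set l \<union> {s, p, q}))" for l p q
  proof -
    have "parcs G `` {x} - (set l \<union> {s, p, q}) = parcs G `` {x} - {s, p, q} - set l" by blast
    then show ?thesis
      using rest[of p q] card_Diff_list[of "parcs G `` {x} - {s, p, q}" l] by simp
  qed
  have dx: "6 \<le> card (R `` {x})" and du: "6 \<le> card (R `` {u})"
    using deg xu by blast+
  have ux: "u \<noteq> x" "u \<noteq> s" using xu us loop by auto
  consider "T = tree_dprime n" | "T = tree_tprime n" | "T = tree_three n"
    using T by blast
  then show ?thesis
  proof cases
    case 1
    obtain p where p: "(u, p) \<in> R" "p \<notin> set [x, s]"
      using pick[OF du, of "[x, s]"] by auto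
    obtain w where w: "(x, w) \<in> R" "w \<notin> set [u, s, p]"
      using pick[OF dx, of "[u, s, p]"] by auto
    obtain q where q: "(w, q) \<in> R" "q \<notin> set [x, u, s, p]"
      using pick[of w "[x, u, s, p]"] deg w(1) by auto
    have "n - 6 \<le> card (parcs G `` {x} - set [u, w, s, p, q])"
      using remove[of "[u, w]" p q] by (simp add: insert_commute)
    moreover have "distinct [x, u, w, s, p, q]"
      using p w q ux sx loop by auto
    ultimately show ?thesis
      unfolding 1
      by (intro contains_tree_dprime[OF G])
        (use R xu us p w q n in \<open>(assumption | auto)\<close>)
  next
    case 2
    obtain v where v: "(x, v) \<in> R" "v \<notin> set [u, s]"
      using pick[OF dx, of "[u, s]"] by auto
    obtain p where p: "(v, p) \<in> R" "p \<notin> set [x, u, s]"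
      using pick[of v "[x, u, s]"] deg v(1) by auto
    obtain w where w: "(x, w) \<in> R" "w \<notin> set [u, v, s, p]"
      using pick[OF dx, of "[u, v, s, p]"] by auto
    obtain q where q: "(w, q) \<in> R" "q \<notin> set [x, u, v, s, p]"
      using pick[of w "[x, u, v, s, p]"] deg w(1) by auto
    have "n - 7 \<le> card (parcs G `` {x} - set [u, v, w, s, p, q])"
      using remove[of "[u, v, w]" p q] by (simp add: insert_commute)
    moreover have "distinct [x, u, v, w, s, p, q]"
      using p v w q ux sx loop by auto
    ultimately show ?thesis
      unfolding 2
      by (intro contains_tree_tprime[OF G])
        (use R xu us p v w q n in \<open>(assumption | auto)\<close>)
  next
    case 3
    obtain p where p: "(u, p) \<in> R" "p \<notin> set [x, s]"
      using pick[OF du, of "[x, s]"] by auto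
    obtain q where q: "(u, q) \<in> R" "q \<notin> set [x, s, p]"
      using pick[OF du, of "[x, s, p]"] by auto
    have "n - 5 \<le> card (parcs G `` {x} - set [u, s, p, q])"
      using remove[of "[u]" p q] by (simp add: insert_commute)
    moreover have "distinct [x, s, p, q]"
      using p q sx by auto
    ultimately show ?thesis
      unfolding 3
      by (intro contains_tree_three[OF G])
        (use R xu us p q n in \<open>(assumption | auto)\<close>)
  qed
qed

lemma pair_graph_graph_complement:
  assumes "pair_graph G"
  shows "pair_graph (graph_complement G)"
proof -
  interpret G: pair_graph G by fact
  have sym: "(v, u) \<in> parcs G" if "(u, v) \<in> parcs G" for u v
    using that G.pair_sym_arcs by (auto simp: symmetric_def dest: symD)
  have "finite (parcs (graph_complement G))"
    by (rule finite_subset[of _ "pverts G \<times> pverts G"])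
      (auto simp: graph_complement_def G.pair_finite_verts)
  then show ?thesis
    using sym G.pair_finite_verts
    by unfold_locales (auto simp: graph_complement_def symmetric_def sym_def arcs_ends_def arc_to_ends_def)
qed

section \<open>The upper bound\<close>

lemma contains_tree_or_star:
  assumes G: "pair_graph G" and n: "n \<ge> 10" and card_V: "card (pverts G) = 2 * n - 5"
    and T: "T \<in> {tree_dprime n, tree_tprime n, tree_three n}"
  shows "contains_copy G T \<or> contains_copy (graph_complement G) (tree_star n)"
proof (rule ccontr)
  assume "\<not> ?thesis"
  then have noT: "\<not> contains_copy G T"
    and noS: "\<not> contains_copy (graph_complement G) (tree_star n)" by blast+
  interpret G: pair_graph G by fact
  define V where "V = pverts G"
  define N where "N y = parcs G `` {y}" for y
  define M where "M y = parcs (graph_complement G) `` {y}" for y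
  have fin: "finite V" and cV: "card V = 2 * n - 5"
    using G.pair_finite_verts card_V by (auto simp: V_def)
  have Nsym: "z \<in> N y \<longleftrightarrow> y \<in> N z" for y z
    using G.pair_sym_arcs by (auto simp: N_def symmetric_def dest: symD)
  have loop: "y \<notin> N y" for y
    using G.pair_no_loops by (fastforce simp: N_def)
  have NV: "N y \<subseteq> V" for y
    using G.in_arcsD2 by (auto simp: N_def V_def)
  have NV': "y \<in> V" if "z \<in> N y" for y z
    using that Nsym NV by blast
  have M_iff: "z \<in> M y \<longleftrightarrow> y \<in> V \<and> z \<in> V \<and> z \<noteq> y \<and> z \<notin> N y" for y z
    by (auto simp: M_def N_def V_def graph_complement_def)
  have MV: "M y \<subseteq> V" for y using M_iff by blast
  have Msym: "z \<in> M y \<longleftrightarrow> y \<in> M z" for y z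
    using M_iff Nsym by blast
  have finN: "finite (N y)" and finM: "finite (M y)" for y
    by (rule finite_subset[OF NV fin], rule finite_subset[OF MV fin])
  have degs: "card (N y) + card (M y) = 2 * n - 6" if "y \<in> V" for y
  proof -
    have "V = insert y (N y \<union> M y)" using M_iff NV that by blast
    moreover have "y \<notin> N y \<union> M y" using loop M_iff by blast
    ultimately have "card V = Suc (card (N y \<union> M y))"
      using finN finM by (metis card_insert_disjoint finite_Un)
    moreover have "card (N y \<union> M y) = card (N y) + card (M y)"
      using finN finM M_iff by (intro card_Un_disjoint) auto
    ultimately show ?thesis using cV by simp
  qed
  have no_star: "card (M x - set [a, b, c]) < n - 4"
    if "a \<in> M x" "b \<in> M a" "c \<in> M b" "b \<noteq> x" "c \<noteq> x" "c \<noteq> a" for x a b c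
    using contains_tree_star[OF pair_graph_graph_complement[OF G], of n x a b c] that noS n
    by (force simp: M_def)
  have M_le: "card (M v) \<le> n - 2" if v: "v \<in> V" for v
  proof (rule ccontr)
    assume "\<not> ?thesis"
    then have large: "n - 1 \<le> card (M v)" by simp
    \<comment> \<open>The path uses up at most three of the \<open>n - 1\<close> neighbours of
      \<open>v\<close>, leaving the \<open>n - 4\<close> leaves required by
      \<open>no_star\<close>.\<close>
    have no_path: False if "a \<in> M v" "b \<in> M a" "c \<in> M b" "b \<noteq> v" "c \<noteq> v" "c \<noteq> a" for a b c
      using no_star[OF that] card_Diff_list[of "M v" "[a, b, c]"] large n by simp
    obtain M0 where M0: "M0 \<subseteq> M v" "card M0 = n - 1" "finite M0"
      using obtain_subset_with_card_n[OF large] by metis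
    have "card (insert v M0) < card V"
      using M0 cV n by (auto simp: card_insert_if)
    then obtain r where r: "r \<in> V" "r \<noteq> v" "r \<notin> M0"
      using card_mono[of "insert v M0" V] M0(3) by force
    \<comment> \<open>\<open>r\<close> brings the set up to \<open>n\<close> vertices, room for all
      of \<open>T\<close>; it may or may not be a complement neighbour of \<open>v\<close>.\<close>
    define W where "W = insert r M0"
    have W: "W \<subseteq> V" "v \<notin> W" "finite W" "card W = n"
      using M0 r n MV M_iff by (auto simp: W_def)
    \<comment> \<open>Of two distinct complement neighbours of \<open>y\<close> in \<open>W\<close>,
      at most one is \<open>r\<close>; the other lies in \<open>M v\<close> and starts a forbidden
      path through \<open>y\<close>.\<close>
    have matching: "b = c" if "y \<in> W" "b \<in> W" "c \<in> W" "b \<in> M y" "c \<in> M y" for y b c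
    proof (rule ccontr)
      assume "b \<noteq> c"
      moreover have "b \<in> M v \<or> c \<in> M v"
        using \<open>b \<noteq> c\<close> that M0(1) by (auto simp: W_def)
      moreover have "y \<noteq> v" "b \<noteq> v" "c \<noteq> v" using that W(2) by auto
      moreover have "y \<in> M b" "y \<in> M c" using that(4,5) Msym by simp_all
      ultimately show False
        using no_path[of b y c] no_path[of c y b] that(4,5) by blast
    qed
    \<comment> \<open>The degree bound for the greedy embedding is at hand only inside
      \<open>W\<close>, so \<open>R\<close> keeps just the edges within \<open>W\<close>.\<close>
    define R where "R = parcs G \<inter> W \<times> W"
    have R: "R `` {y} = W - {y} - M y" if "y \<in> W" for y
      using that W(1) M_iff loop by (auto simp: R_def N_def)
    have degR: "n - 2 \<le> card (R `` {y})" if y: "y \<in> W" for y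
    proof -
      have "card (W \<inter> M y) \<le> 1"
        using matching[OF y] card_le_Suc0_iff_eq[of "W \<inter> M y"] W(3) by simp
      moreover have "W - {y} - M y = W - {y} - W \<inter> M y" by blast
      moreover have "card (W - {y} - W \<inter> M y) \<ge> card (W - {y}) - card (W \<inter> M y)"
        using W(3) by (intro diff_card_le_card_Diff) auto
      ultimately show ?thesis using R[OF y] W(3,4) y by simp
    qed
    have deg6: "6 \<le> card (R `` {y}) \<and> 6 \<le> card (R `` {z})" if "(y, z) \<in> R" for y z
      using that degR[of y] degR[of z] n by (auto simp: R_def)
    have Rsym: "(z, y) \<in> R" if "(y, z) \<in> R" for y z
      using that Nsym by (auto simp: R_def N_def)
    have RG: "R \<subseteq> parcs G" by (simp add: R_def)
    have no_tree: "card (insert s (R `` {x})) < n - 1"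
      if "(x, u) \<in> R" "(u, s) \<in> R" "s \<noteq> x" for x u s
    proof (rule ccontr)
      assume "\<not> ?thesis"
      then have "n - 1 \<le> card (insert s (R `` {x}))" by simp
      then have "contains_copy G T"
        by (rule contains_tree_if_large_degree[OF G n RG T that _ deg6])
      then show False using noT by blast
    qed
    have pickR: "\<exists>z. (y, z) \<in> R \<and> z \<noteq> w" if "y \<in> W" for y w
    proof -
      have "length [w] < card (R `` {y})" using degR[OF that] n by simp
      from ex_not_in_list[OF this] show ?thesis by auto
    qed
    have rW: "r \<in> W" by (simp add: W_def)
    \<comment> \<open>With \<open>n - 1\<close> neighbours in \<open>W\<close> the vertex
      \<open>r\<close> would carry \<open>T\<close>; hence it misses some \<open>s\<close> in
      \<open>W\<close>.\<close>
    have cards: "card (R `` {r}) < n - 1"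
    proof -
      obtain u where u: "(r, u) \<in> R"
        using pickR[OF rW] by blast
      have "u \<in> W" using u by (simp add: R_def)
      then obtain s where s: "(u, s) \<in> R" "s \<noteq> r"
        using pickR by blast
      have "finite (R `` {r})" using W(3) R[OF rW] by simp
      then have "card (R `` {r}) \<le> card (insert s (R `` {r}))"
        by (intro card_mono) auto
      then show ?thesis using no_tree[OF u s] by linarith
    qed
    have "\<not> W - {r} \<subseteq> R `` {r}"
    proof
      assume "W - {r} \<subseteq> R `` {r}"
      then have "R `` {r} = W - {r}" using R[OF rW] by blast
      then show False using cards W(3,4) rW by simp
    qed
    then obtain s where s: "s \<in> W" "s \<noteq> r" "s \<notin> R `` {r}" by blast
    obtain u where u: "(s, u) \<in> R"
      using pickR[OF s(1)] by blast
    have "u \<in> W" "u \<noteq> s" "u \<notin> M s" using u R[OF s(1)] by blast+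
    moreover have "s \<in> M r" using s R[OF rW] by blast
    \<comment> \<open>As \<open>s\<close> is the only complement neighbour of \<open>r\<close> in
      \<open>W\<close>, the vertex \<open>u\<close> joins \<open>r\<close> to \<open>s\<close> in
      \<open>G\<close>; counting \<open>s\<close> lifts the \<open>n - 2\<close> neighbours of
      \<open>r\<close> to the \<open>n - 1\<close> needed.\<close>
    ultimately have "u \<in> R `` {r}"
      using R[OF rW] matching[OF rW \<open>u \<in> W\<close> s(1)] Msym by blast
    then have "card (insert s (R `` {r})) < n - 1"
      using no_tree[of r u s] Rsym[OF u] s(2) by blast
    moreover have "card (insert s (R `` {r})) = Suc (card (R `` {r}))"
      using s(3) W(3) R[OF rW] by simp
    ultimately show False using degR[OF rW] n by linarith
  qed
  have N_ge: "n - 4 \<le> card (N y)" if "y \<in> V" for y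
    using degs[OF that] M_le[OF that] n by linarith
  have no_tree: "card (insert s (N x)) < n - 1"
    if "u \<in> N x" "s \<in> N u" "s \<noteq> x" for x u s
  proof -
    \<comment> \<open>All degrees are now at least \<open>n - 4\<close>, hence at least 6, so the
      greedy embedding applies to the whole of \<open>G\<close>.\<close>
    have deg6: "6 \<le> card (N y) \<and> 6 \<le> card (N z)" if "z \<in> N y" for y z
      using N_ge[OF NV'[OF that]] N_ge[of z] subsetD[OF NV that] n by linarith
    show ?thesis
    proof (rule ccontr)
      assume "\<not> ?thesis"
      then have "n - 1 \<le> card (insert s (N x))" by simp
      then have "contains_copy G T"
        using that deg6
        by (intro contains_tree_if_large_degree[OF G n subset_refl T, of x u s])
          (simp_all add: N_def)
      then show False using noT by blast
    qed
  qed
  have pickN: "\<exists>z. z \<in> N y \<and> z \<noteq> w" if "y \<in> V" for y w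
  proof -
    have "length [w] < card (N y)" using N_ge[OF that] n by simp
    from ex_not_in_list[OF this] show ?thesis by auto
  qed
  have N_le: "card (N x) \<le> n - 3" if x: "x \<in> V" for x
  proof (rule ccontr)
    assume "\<not> ?thesis"
    then have large: "n - 2 \<le> card (N x)" by simp
    \<comment> \<open>A neighbour of \<open>u\<close> outside would be the extra vertex at distance
      two that brings the count to \<open>n - 1\<close>.\<close>
    have closed: "N u \<subseteq> insert x (N x)" if "u \<in> N x" for u
    proof (rule subsetI, rule ccontr)
      fix s assume s: "s \<in> N u" "s \<notin> insert x (N x)"
      then have "Suc (card (N x)) < n - 1"
        using no_tree[OF that, of s] finN[of x] by simp
      then show False using large by linarith
    qed
    obtain u where u: "u \<in> N x"
      using pickN[OF x] by blast
    then have "u \<in> V" using NV by blast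
    then obtain s where s: "s \<in> N u" "s \<noteq> x"
      using pickN by blast
    then have "insert s (N x) = N x" using closed[OF u] by blast
    then have cN: "card (N x) = n - 2" using no_tree[OF u s] large by simp
    \<comment> \<open>By \<open>closed\<close> no edge leaves \<open>C\<close>, so the
      \<open>(2 * n - 5) - (n - 1) = n - 4\<close> vertices outside have degree at most
      \<open>n - 5\<close>.\<close>
    define C where "C = insert x (N x)"
    have C: "C \<subseteq> V" "card C = n - 1" "finite C"
      using x NV cN loop finN n by (auto simp: C_def)
    have cD: "card (V - C) = n - 4"
      using C fin cV n by (simp add: card_Diff_subset)
    then have "V - C \<noteq> {}" using n by fastforce
    then obtain y where y: "y \<in> V - C" by blast
    have "N y \<subseteq> V - C - {y}"
      using closed Nsym NV loop y by (fastforce simp: C_def)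
    then have "card (N y) \<le> card (V - C - {y})"
      using fin by (intro card_mono) auto
    then have "card (N y) \<le> n - 5"
      using y cD fin by simp
    then show False using N_ge[of y] y n by simp
  qed
  have M_ge: "n - 3 \<le> card (M v)" if "v \<in> V" for v
    using degs[OF that] N_le[OF that] n by linarith
  have pickM: "\<exists>z. z \<in> M y \<and> z \<noteq> w" if "y \<in> V" for y w
  proof -
    have "length [w] < card (M y)" using M_ge[OF that] n by simp
    from ex_not_in_list[OF this] show ?thesis by auto
  qed
  \<comment> \<open>Without a common complement neighbour, all of \<open>M a\<close> would have to
    fit into \<open>N v\<close> without \<open>a\<close>; \<open>v\<close> is not in
    \<open>M a\<close>, being adjacent to \<open>a\<close>.\<close>
  have other: "\<exists>s. s \<in> M a \<and> s \<in> M v" if v: "v \<in> V" and a: "a \<in> N v"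
    and less: "card (N v) < Suc (card (M a))" for v a
  proof (rule ccontr)
    assume *: "\<not> ?thesis"
    have "v \<notin> M a" using a M_iff Nsym by blast
    then have "M a \<subseteq> N v - {a}" using * M_iff v by blast
    then have "card (M a) \<le> card (N v - {a})"
      using finN by (intro card_mono) auto
    moreover have "Suc (card (N v - {a})) = card (N v)"
      using a finN[of v] by (metis card_Suc_Diff1)
    ultimately show False using less by linarith
  qed
  have cM: "card (M v) = n - 3" if v: "v \<in> V" for v
  proof (rule ccontr)
    assume "card (M v) \<noteq> n - 3"
    then have cMv: "card (M v) = n - 2" using M_ge[OF v] M_le[OF v] by linarith
    then have cNv: "card (N v) = n - 4" using degs[OF v] n by linarith
    then obtain a where a: "a \<in> N v"
      using pickN[OF v] by blast
    then have aV: "a \<in> V" using NV by blast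
    have "card (N v) < Suc (card (M a))" using M_ge[OF aV] cNv by linarith
    then obtain s where s: "s \<in> M a" "s \<in> M v" using other[OF v a] by blast
    obtain c where c: "c \<in> M a" "c \<noteq> s"
      using pickM[OF aV] by blast
    have "v \<notin> M a" "a \<notin> M v" "a \<noteq> v" using a M_iff Nsym loop by blast+
    \<comment> \<open>The complement path \<open>v\<close>, \<open>s\<close>, \<open>a\<close>,
      \<open>c\<close> costs at most \<open>s\<close> and \<open>c\<close> among the
      \<open>n - 2\<close> complement neighbours of \<open>v\<close>, since \<open>a\<close> is not
      one; \<open>n - 4\<close> leaves remain.\<close>
    then have "card (M v - set [s, a, c]) < n - 4"
      using no_star[of s v a c] s c Msym by blast
    moreover have "M v - set [s, a, c] = M v - set [s, c]"
      using \<open>a \<notin> M v\<close> by auto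
    ultimately show False
      using card_Diff_list[of "M v" "[s, c]"] cMv n by simp
  qed
  have cN: "card (N v) = n - 3" if "v \<in> V" for v
    using degs[OF that] cM[OF that] n by linarith
  have "V \<noteq> {}" using cV n by fastforce
  then obtain v where v: "v \<in> V" by blast
  have MN: "M a = M v" if a: "a \<in> N v" for a
  proof -
    have aV: "a \<in> V" using a NV by blast
    obtain s where s: "s \<in> M a" "s \<in> M v"
      using other[OF v a] cN[OF v] cM[OF aV] by auto
    have nv: "v \<notin> M a" "a \<notin> M v" "a \<noteq> v" using a M_iff Nsym loop by blast+
    \<comment> \<open>With only \<open>n - 3\<close> complement neighbours the same path still works
      if \<open>c\<close> is outside \<open>M v\<close>, for then it costs only \<open>s\<close>. So
      \<open>M a\<close> lies in \<open>M v\<close>, and equal degrees give equality.\<close>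
    have "c \<notin> N v" if c: "c \<in> M a" for c
    proof
      assume cN': "c \<in> N v"
      then have "c \<notin> M v" "c \<noteq> v" "c \<noteq> s" using s M_iff loop by blast+
      then have "card (M v - set [s, a, c]) < n - 4"
        using no_star[of s v a c] s c nv Msym by blast
      moreover have "M v - set [s, a, c] = M v - set [s]"
        using nv(2) \<open>c \<notin> M v\<close> by auto
      ultimately show False
        using card_Diff_list[of "M v" "[s]"] cM[OF v] n by simp
    qed
    then have "M a \<subseteq> M v" using nv(1) M_iff v by blast
    then show ?thesis
      using card_subset_eq[OF finM] cM v aV by metis
  qed
  obtain s where s: "s \<in> M v"
    using pickM[OF v] by blast
  \<comment> \<open>\<open>v\<close> and its \<open>n - 3\<close> neighbours are all complement
    neighbours of \<open>s\<close>, one more than regularity allows.\<close>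
  then have "insert v (N v) \<subseteq> M s" using MN Msym by blast
  then have "card (insert v (N v)) \<le> card (M s)"
    using finM by (intro card_mono)
  moreover have "s \<in> V" using s MV by blast
  ultimately show False
    using cM[of s] cN[OF v] loop finN n by simp
qed

section \<open>The lower bound\<close>

text \<open>The order \<open>N\<close> is a parameter because a counterexample is given for every
  order below \<open>2 * n - 5\<close>, not only for two full cliques.\<close>

definition two_cliques :: "nat \<Rightarrow> nat \<Rightarrow> nat pair_pre_digraph" where
  "two_cliques k N = \<lparr> pverts = {0..<N},
     parcs = {(u, v). u < N \<and> v < N \<and> u \<noteq> v \<and> (u < k \<longleftrightarrow> v < k)} \<rparr>"

lemma pair_graph_two_cliques: "pair_graph (two_cliques k N)"
proof -
  have "finite (parcs (two_cliques k N))"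
    by (rule finite_subset[of _ "{0..<N} \<times> {0..<N}"]) (auto simp: two_cliques_def)
  then show ?thesis
    by unfold_locales (auto simp: two_cliques_def symmetric_def sym_def arcs_ends_def arc_to_ends_def)
qed

lemma card_clique_le:
  assumes "N \<le> 2 * k"
  shows "card {v. v < N \<and> (v < k \<longleftrightarrow> b)} \<le> k"
proof (cases b)
  case True
  then have "card {v. v < N \<and> (v < k \<longleftrightarrow> b)} \<le> card {..<k}"
    by (intro card_mono) auto
  then show ?thesis by simp
next
  case False
  then have "card {v. v < N \<and> (v < k \<longleftrightarrow> b)} \<le> card {k..<N}"
    by (intro card_mono) auto
  then show ?thesis using assms by simp
qed

text \<open>A connected graph must lie within one clique, and \<open>n\<close> vertices do not fit
  into \<open>n - 3\<close>.\<close>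

lemma two_cliques_avoid_tree:
  assumes "n \<ge> 10" and "N \<le> 2 * (n - 3)"
    and "T \<in> {tree_dprime n, tree_tprime n, tree_three n}"
  shows "\<not> contains_copy (two_cliques (n - 3) N) T"
proof
  let ?k = "n - 3"
  let ?E0 = "{(0, i) | i. 1 \<le> i \<and> i \<le> n - 4} :: (nat \<times> nat) set"
  assume copy: "contains_copy (two_cliques ?k N) T"
  \<comment> \<open>Common shape of the three trees: a star with centre 0 and \<open>n - 4\<close>
    leaves, with three pendant vertices attached at star leaves \<open>a\<close>, \<open>b\<close>,
    \<open>c\<close>, which may coincide.\<close>
  obtain E a b c where T: "T = graph_of_edges n (?E0 \<union> E)"
    and E: "E = {(a, n - 3), (b, n - 2), (c, n - 1)}"
    and abc: "a \<in> {1..n - 4}" "b \<in> {1..n - 4}" "c \<in> {1..n - 4}"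
  proof -
    consider "T = tree_dprime n" | "T = tree_tprime n" | "T = tree_three n"
      using assms(3) by blast
    then show thesis
    proof cases
      case 1
      then show thesis
        using that[OF _ refl, of 1 1 2] assms(1) by (simp add: tree_dprime_def)
    next
      case 2
      then show thesis
        using that[OF _ refl, of 1 2 3] assms(1) by (simp add: tree_tprime_def)
    next
      case 3
      then show thesis
        using that[OF _ refl, of "n - 4" "n - 4" "n - 4"] assms(1) by (simp add: tree_three_def)
    qed
  qed
  obtain f where inj: "inj_on f {0..<n}" and V: "f ` {0..<n} \<subseteq> pverts (two_cliques ?k N)"
    and arc: "\<And>i j. (i, j) \<in> ?E0 \<union> E \<Longrightarrow> (f i, f j) \<in> parcs (two_cliques ?k N)"
    using contains_copyE[OF copy[unfolded T]] by blast
  have side: "f i < ?k \<longleftrightarrow> f j < ?k" if "(i, j) \<in> ?E0 \<union> E" for i j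
    using arc[OF that] by (simp add: two_cliques_def)
  have near: "f i < ?k \<longleftrightarrow> f 0 < ?k" if "i \<le> n - 4" for i
    using side[of 0 i] that by (cases "i = 0") auto
  have "(a, n - 3) \<in> ?E0 \<union> E" "(b, n - 2) \<in> ?E0 \<union> E" "(c, n - 1) \<in> ?E0 \<union> E"
    unfolding E by blast+
  note this[THEN side]
  moreover have "f a < ?k \<longleftrightarrow> f 0 < ?k" "f b < ?k \<longleftrightarrow> f 0 < ?k" "f c < ?k \<longleftrightarrow> f 0 < ?k"
    using abc by (intro near; simp)+
  ultimately have far: "f (n - 3) < ?k \<longleftrightarrow> f 0 < ?k" "f (n - 2) < ?k \<longleftrightarrow> f 0 < ?k"
    "f (n - 1) < ?k \<longleftrightarrow> f 0 < ?k" by blast+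
  have same: "f i < ?k \<longleftrightarrow> f 0 < ?k" if "i < n" for i
  proof -
    have "i \<le> n - 4 \<or> i = n - 3 \<or> i = n - 2 \<or> i = n - 1"
      using that by arith
    then show ?thesis
      using near far by blast
  qed
  have "f ` {0..<n} \<subseteq> {v. v < N \<and> (v < ?k \<longleftrightarrow> f 0 < ?k)}"
  proof
    fix w assume "w \<in> f ` {0..<n}"
    then obtain i where i: "w = f i" "i < n" by auto
    then have "f i \<in> pverts (two_cliques ?k N)" using V by auto
    then show "w \<in> {v. v < N \<and> (v < ?k \<longleftrightarrow> f 0 < ?k)}"
      using same[OF i(2)] i(1) by (simp add: two_cliques_def)
  qed
  then have "card (f ` {0..<n}) \<le> card {v. v < N \<and> (v < ?k \<longleftrightarrow> f 0 < ?k)}"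
    by (intro card_mono) auto
  also have "\<dots> \<le> ?k" using card_clique_le[OF assms(2)] .
  finally show False using card_image[OF inj] assms(1) by simp
qed

text \<open>The complement is bipartite, and the larger colour class of the tree has \<open>n - 2\<close> vertices.\<close>

lemma two_cliques_complement_avoids_star:
  assumes "n \<ge> 4" and "N \<le> 2 * (n - 3)"
  shows "\<not> contains_copy (graph_complement (two_cliques (n - 3) N)) (tree_star n)"
proof
  let ?k = "n - 3"
  let ?E = "{(0, i) | i. 1 \<le> i \<and> i \<le> n - 3} \<union> {(n - 3, n - 2), (n - 2, n - 1)} :: (nat \<times> nat) set"
  let ?H = "graph_complement (two_cliques ?k N)"
  \<comment> \<open>The vertices at odd distance from 0: its neighbours and, at distance three, the
    end \<open>n - 1\<close> of the path.\<close>
  let ?I = "insert (n - 1) {1..n - 3}"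
  assume copy: "contains_copy ?H (tree_star n)"
  obtain f where inj: "inj_on f {0..<n}" and V: "f ` {0..<n} \<subseteq> pverts ?H"
    and arc: "\<And>i j. (i, j) \<in> ?E \<Longrightarrow> (f i, f j) \<in> parcs ?H"
    using contains_copyE[OF copy[unfolded tree_star_def]] by blast
  have side: "f j < ?k \<longleftrightarrow> \<not> f i < ?k" if "(i, j) \<in> ?E" for i j
    using arc[OF that] by (auto simp: graph_complement_def two_cliques_def)
  have near: "f i < ?k \<longleftrightarrow> \<not> f 0 < ?k" if "i \<in> {1..n - 3}" for i
    using side[of 0 i] that by auto
  have "f (n - 1) < ?k \<longleftrightarrow> \<not> f 0 < ?k"
    using near[of "n - 3"] side[of "n - 3" "n - 2"] side[of "n - 2" "n - 1"] assms(1) by auto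
  with near have far: "f i < ?k \<longleftrightarrow> \<not> f 0 < ?k" if "i \<in> ?I" for i
    using that by blast
  have I: "?I \<subseteq> {0..<n}" using assms(1) by auto
  have "f ` ?I \<subseteq> {v. v < N \<and> (v < ?k \<longleftrightarrow> \<not> f 0 < ?k)}"
  proof
    fix w assume "w \<in> f ` ?I"
    then obtain i where i: "w = f i" "i \<in> ?I" by blast
    then have "f i \<in> pverts ?H" using V I by blast
    then show "w \<in> {v. v < N \<and> (v < ?k \<longleftrightarrow> \<not> f 0 < ?k)}"
      using far[OF i(2)] i(1) by (simp add: graph_complement_def two_cliques_def)
  qed
  then have "card (f ` ?I) \<le> card {v. v < N \<and> (v < ?k \<longleftrightarrow> \<not> f 0 < ?k)}"
    by (intro card_mono) auto
  also have "\<dots> \<le> ?k" using card_clique_le[OF assms(2)] .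
  finally have "card ?I \<le> ?k"
    using card_image[OF inj_on_subset[OF inj I]] by simp
  moreover have "card ?I = Suc (n - 3)"
    using assms(1) by (subst card_insert_disjoint) auto
  ultimately show False by simp
qed

theorem theorem3p5:
  fixes n :: nat and T :: "nat pair_pre_digraph"
  assumes "n \<ge> 10"
    and "T \<in> {tree_dprime n, tree_tprime n, tree_three n}"
  shows "ramsey_number T (tree_star n) = 2 * n - 5"
  unfolding ramsey_number_def
proof (rule Least_equality)
  show "0 < 2 * n - 5 \<and> (\<forall>G :: nat pair_pre_digraph. pair_graph G \<and> card (pverts G) = 2 * n - 5 \<longrightarrow>
      contains_copy G T \<or> contains_copy (graph_complement G) (tree_star n))"
    using contains_tree_or_star assms by auto
next
  fix N
  assume N: "0 < N \<and> (\<forall>G :: nat pair_pre_digraph. pair_graph G \<and> card (pverts G) = N \<longrightarrow>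
      contains_copy G T \<or> contains_copy (graph_complement G) (tree_star n))"
  show "2 * n - 5 \<le> N"
  proof (rule ccontr)
    assume "\<not> ?thesis"
    then have le: "N \<le> 2 * (n - 3)" by simp
    have "card (pverts (two_cliques (n - 3) N)) = N"
      by (simp add: two_cliques_def)
    then show False
      using N pair_graph_two_cliques two_cliques_avoid_tree[OF assms(1) le assms(2)]
        two_cliques_complement_avoids_star[OF _ le] assms(1) by fastforce
  qed
qed

end
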